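(* Let $n \ge 2$ be an integer, let $G = \mathbb{Z}/n\mathbb{Z}$, and let $p(G)$ be the smallest prime dividing $n$. Let $A, B \subseteq G$ with $|A| = k$ and $|B| = l$, where $k, l \geq 3$, and suppose that $p(G) > k + l - 3$. Suppose further that $A$ and $B$ are arithmetic progressions with the same common difference, i.e. there exist $a, b, d \in G$ with $A = \{a + sd \mid 0 \le s \le k-1\}$ and $B = \{b + td \mid 0 \le t \le l-1\}$. If $|A \dot{+} B| = |A| + |B| - 3$, then $A = B$.
   Context: For subsets $A, B$ of an abelian group (written additively), the restricted sumset is $A \dot{+} B := \{a + b \mid a \in A,\ b \in B,\ a \neq b\}$. *)

theory Defs
  imports "HOL-Number_Theory.Residues"
begin

abbreviation Zmod :: "nat \<Rightarrow> int ring" where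
  "Zmod n \<equiv> residue_ring (int n)"

definition smallest_prime_divisor :: "nat \<Rightarrow> nat" where
  "smallest_prime_divisor n = (LEAST p. prime p \<and> p dvd n)"

definition restricted_sumset :: "('a, 'm) ring_scheme \<Rightarrow> 'a set \<Rightarrow> 'a set \<Rightarrow> 'a set" where
  "restricted_sumset G A B = {a \<oplus>\<^bsub>G\<^esub> b |a b. a \<in> A \<and> b \<in> B \<and> a \<noteq> b}"

(* The progression with first term a, difference d and index running over 0, ..., m - 1;
   the terms are not required to be distinct. *)
definition arith_prog :: "('a, 'm) ring_scheme \<Rightarrow> 'a \<Rightarrow> 'a \<Rightarrow> nat \<Rightarrow> 'a set" where
  "arith_prog G a d m = {a \<oplus>\<^bsub>G\<^esub> [s] \<cdot>\<^bsub>G\<^esub> d |s :: nat. s < m}"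

end

theory Submission
  imports Defs
begin

text \<open>
  Write \<open>A\<close> and \<open>B\<close> as \<open>a + s d\<close> and \<open>b + t d\<close>. Every multiple \<open>j d\<close> with \<open>0 < \<bar>j\<bar> \<le> k + l - 3\<close> is
  nonzero, so the sums \<open>a + b + u d\<close> with \<open>0 < u < k + l - 2\<close> are \<open>k + l - 3\<close> distinct elements, which
  differ from both extreme sums \<open>u = 0\<close> and \<open>u = k + l - 2\<close> (these two may coincide). Each of them has
  two representations \<open>(s, t)\<close> and \<open>(s + 1, t - 1)\<close>; not both can be diagonal since \<open>2 d \<noteq> 0\<close>, so it lies
  in the restricted sumset. By cardinality nothing else does; so the only representation of each
  extreme sum is diagonal, meaning \<open>A\<close> and \<open>B\<close> share their first and their last terms.
\<close>

lemma coprime_less_smallest_prime_divisor: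
  assumes "0 < j" "j < smallest_prime_divisor n"
  shows "coprime j n"
proof (rule ccontr)
  assume "\<not> coprime j n"
  then have "gcd j n \<noteq> 1"
    by (simp add: coprime_iff_gcd_eq_1)
  then obtain q where q: "prime q" "q dvd gcd j n"
    using prime_factor_nat by blast
  have "smallest_prime_divisor n \<le> q"
    unfolding smallest_prime_divisor_def using q by (intro Least_le) auto
  moreover have "q \<le> j"
    using q assms(1) by (auto dest: dvd_imp_le)
  ultimately show False
    using assms(2) by simp
qed

text \<open>A nonzero \<open>i\<close> this small shares no prime factor with \<open>n\<close>, so
  it is a unit modulo \<open>n\<close> and can be cancelled.\<close>

lemma dvd_mult_cancel_less_smallest_prime_divisor:
  fixes i d :: int
  assumes "int n dvd i * d" "\<bar>i\<bar> < int (smallest_prime_divisor n)" "i \<noteq> 0"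
  shows "int n dvd d"
proof -
  have "coprime (nat \<bar>i\<bar>) n"
    using assms(2,3) by (intro coprime_less_smallest_prime_divisor) linarith+
  then have "coprime \<bar>i\<bar> (int n)"
    by (metis coprime_int_iff int_nat_eq abs_ge_zero)
  then have "coprime (int n) i"
    by (simp add: coprime_commute)
  then show ?thesis
    using assms(1) by (simp add: coprime_dvd_mult_right_iff)
qed

lemma arith_prog_Zmod:
  assumes "n \<ge> 2"
  shows "arith_prog (Zmod n) a d m = {(a + int s * d) mod int n |s. s < m}"
proof -
  interpret residues "int n" "Zmod n"
    using assms by unfold_locales auto
  have "[s] \<cdot>\<^bsub>Zmod n\<^esub> d = (int s * d) mod int n" for s :: nat
    by (induction s)
       (simp_all add: add_pow_def nat_pow_def res_zero_eq res_add_eq mod_simps algebra_simps)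
  then show ?thesis
    by (simp add: arith_prog_def res_add_eq mod_simps)
qed

lemma restricted_sumset_Zmod:
  "restricted_sumset (Zmod n) A B = {(x + y) mod int n |x y. x \<in> A \<and> y \<in> B \<and> x \<noteq> y}"
  by (simp add: restricted_sumset_def residue_ring_def)

theorem theorem5p1:
  fixes n k l :: nat and A B :: "int set"
  assumes "n \<ge> 2"
    and "A \<subseteq> carrier (Zmod n)" and "B \<subseteq> carrier (Zmod n)"
    and "card A = k" and "card B = l"
    and "k \<ge> 3" and "l \<ge> 3"
    and "smallest_prime_divisor n > k + l - 3"
    and "\<exists>a \<in> carrier (Zmod n). \<exists>b \<in> carrier (Zmod n). \<exists>d \<in> carrier (Zmod n).
           A = arith_prog (Zmod n) a d k \<and> B = arith_prog (Zmod n) b d l"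
    and "card (restricted_sumset (Zmod n) A B) = card A + card B - 3"
  shows "A = B"
proof -
  obtain a b d where ab: "a \<in> carrier (Zmod n)" "b \<in> carrier (Zmod n)"
    and A: "A = arith_prog (Zmod n) a d k" and B: "B = arith_prog (Zmod n) b d l"
    using assms(9) by blast
  have A_eq: "A = {(a + int s * d) mod int n |s. s < k}"
    unfolding A by (rule arith_prog_Zmod[OF assms(1)])
  have B_eq: "B = {(b + int t * d) mod int n |t. t < l}"
    unfolding B by (rule arith_prog_Zmod[OF assms(1)])
  \<comment> \<open>Otherwise \<open>A\<close> would collapse to a single point, although
    \<open>k\<close> is at least 3.\<close>
  have not_dvd: "\<not> int n dvd d"
  proof
    assume "int n dvd d"
    then have "(a + int s * d) mod int n = a mod int n" for s
      by (auto simp: mod_eq_dvd_iff)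
    then have "A \<subseteq> {a mod int n}"
      by (auto simp: A_eq)
    then have "card A \<le> 1"
      by (metis card.empty card_1_singleton_iff One_nat_def subset_singletonD le_numeral_extra(4) zero_le_one)
    then show False
      using assms(4,6) by simp
  qed
  have zero_multiple: "i = 0" if "int n dvd i * d" "\<bar>i\<bar> \<le> int (k + l) - 3" for i
    using dvd_mult_cancel_less_smallest_prime_divisor[OF that(1)] that(2) assms(6-8) not_dvd
    by linarith
  \<comment> \<open>The sum of term \<open>s\<close> of \<open>A\<close> and term \<open>t\<close>
    of \<open>B\<close> depends only on \<open>u = s + t\<close>.\<close>
  define f where "f u = (a + b + int u * d) mod int n" for u
  have f_eqD: "u = v" if "f u = f v" "\<bar>int u - int v\<bar> \<le> int (k + l) - 3" for u v
  proof -
    have "int n dvd (int u - int v) * d"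
      using that(1) by (simp add: f_def mod_eq_dvd_iff algebra_simps)
    then show ?thesis
      using zero_multiple that(2) by fastforce
  qed
  let ?R = "restricted_sumset (Zmod n) A B"
  have in_R: "f (s + t) \<in> ?R"
    if "s < k" "t < l" "(a + int s * d) mod int n \<noteq> (b + int t * d) mod int n" for s t
  proof -
    have "f (s + t) = ((a + int s * d) mod int n + (b + int t * d) mod int n) mod int n"
      unfolding f_def mod_add_eq by (simp add: algebra_simps)
    then show ?thesis
      unfolding restricted_sumset_Zmod A_eq B_eq using that by blast
  qed
  have "f ` {1..k + l - 3} \<subseteq> ?R"
  proof safe
    fix u assume u: "u \<in> {1..k + l - 3}"
    \<comment> \<open>The largest \<open>s\<close> for which \<open>Suc s\<close> still indexes a
      term of \<open>A\<close> and \<open>u - s - 1\<close> does not go negative; this keeps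
      \<open>t\<close> at most \<open>l - 2\<close>.\<close>
    define s where "s = min (u - 1) (k - 2)"
    define t where "t = u - s - 1"
    have st: "Suc s < k" "Suc t < l" "u = s + Suc t" "u = Suc s + t"
      using u assms(6,7) unfolding s_def t_def atLeastAtMost_iff by linarith+
    have "\<not> ((a + int s * d) mod int n = (b + int (Suc t) * d) mod int n \<and>
             (a + int (Suc s) * d) mod int n = (b + int t * d) mod int n)"
    proof safe
      assume "(a + int s * d) mod int n = (b + int (Suc t) * d) mod int n"
        and "(a + int (Suc s) * d) mod int n = (b + int t * d) mod int n"
      \<comment> \<open>Subtracting the two coincidences eliminates \<open>a\<close> and
        \<open>b\<close>.\<close>
      then have "int n dvd (a + int (Suc s) * d - (b + int t * d))
                   - (a + int s * d - (b + int (Suc t) * d))"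
        unfolding mod_eq_dvd_iff by (rule dvd_diff[rotated])
      then have "int n dvd 2 * d"
        by (simp add: algebra_simps)
      then show False
        using zero_multiple[of 2] assms(6,7) by simp
    qed
    then show "f u \<in> ?R"
      using in_R[of s "Suc t"] in_R[of "Suc s" t] st by auto
  qed
  moreover have "inj_on f {1..k + l - 3}"
    by (intro inj_onI f_eqD) auto
  then have "card (f ` {1..k + l - 3}) = card ?R"
    using assms(4,5,10) by (simp add: card_image)
  moreover have "finite ?R"
    using assms(4-7,10) by (intro card_ge_0_finite) simp
  ultimately have R: "?R = f ` {1..k + l - 3}"
    by (metis card_subset_eq)
  have "f 0 \<notin> ?R"
    unfolding R using f_eqD[of 0] by force
  then have "a mod int n = b mod int n"
    using in_R[of 0 0] assms(6,7) by auto
  \<comment> \<open>Elements of the carrier are their own residues.\<close>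
  then have "a = b"
    using ab by (simp add: residue_ring_def)
  \<comment> \<open>The index \<open>k + l - 2\<close> is compared only with indices from 1 on; its
    distance to 0 would exceed the bound in \<open>f_eqD\<close> by one.\<close>
  have "f (k + l - 2) \<notin> ?R"
  proof
    assume "f (k + l - 2) \<in> ?R"
    then obtain u where "u \<in> {1..k + l - 3}" "f (k + l - 2) = f u"
      unfolding R by blast
    moreover from this have "k + l - 2 = u"
      using assms(6,7) by (intro f_eqD) auto
    ultimately show False
      using assms(6,7) unfolding atLeastAtMost_iff by linarith
  qed
  moreover have "k - 1 + (l - 1) = k + l - 2"
    using assms(6,7) by simp
  ultimately have "(a + int (k - 1) * d) mod int n = (b + int (l - 1) * d) mod int n"
    using in_R[of "k - 1" "l - 1"] assms(6,7) by auto
  \<comment> \<open>With equal first terms, equal last terms force \<open>k = l\<close>, since the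
    difference of the lengths is within the range of \<open>zero_multiple\<close>.\<close>
  then have "int n dvd (int (k - 1) - int (l - 1)) * d"
    by (simp add: \<open>a = b\<close> mod_eq_dvd_iff algebra_simps)
  then have "int (k - 1) - int (l - 1) = 0"
    using assms(6,7) by (intro zero_multiple) auto
  then have "k = l"
    using assms(6,7) by simp
  then show "A = B"
    by (simp add: A B \<open>a = b\<close>)
qed

end
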